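(* One has $$C_n(U,V)\le 2^n\bigl(n\ln n+n\ln\ln n+n+o(n)\bigr)\frac{|V+U|}{|V|}\quad\text{as } n\to\infty,$$ where the $o(n)$ term depends only on $n$. That is, there is a real sequence $(\varepsilon_n)_{n\ge2}$ with $\varepsilon_n\to0$ as $n\to\infty$ such that for every $n\ge2$ and all $0$-symmetric closed convex bodies $U,V\subset\mathbb{R}^n$, $$C_n(U,V)\le 2^n\bigl(n\ln n+n\ln\ln n+n+\varepsilon_n n\bigr)\frac{|V+U|}{|V|}.$$
   Context: A convex body is a compact convex set with nonempty interior; it is $0$-symmetric if $A=-A$. $A+B$ denotes the Minkowski sum. $|A|$ denotes the volume (Lebesgue measure) of a body $A$. A continuous function $f:\mathbb{R}^n\to\mathbb{C}$ is positive definite if for every finite $Y\subset\mathbb{R}^n$ and all complex numbers $\{c_a: a\in Y\}$ one has $\sum_{a,b\in Y}c_a\overline{c_b}f(a-b)\ge 0$. A double positive definite function, written $f\succeq 0$, is a continuous positive definite function $f$ on $\mathbb{R}^n$ with values in $\mathbb{R}_+=[0,\infty)$. For $0$-symmetric closed convex bodies $U,V\subset\mathbb{R}^n$, $$C_n(U,V):=\sup_{f\succeq 0,\ f\ne 0}\frac{\frac{1}{|V|}\int_V f(x)\,dx}{\frac{1}{|U|}\int_U f(x)\,dx}.$$ *)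

theory Defs
  imports "HOL-Analysis.Analysis" "HOL-Library.Function_Algebras"
begin

text \<open>
  The dimension \<open>n\<close> has to be quantified inside the statement, so \<open>\<real>\<^sup>n\<close> is the library's
  \<^const>\<open>Euclidean_space\<close>: the sequences \<open>x :: nat \<Rightarrow> real\<close> with \<open>x i = 0\<close> for \<open>i \<ge> n\<close>, with the
  product topology.  Functions form a real vector space under the pointwise operations, so that
  \<^const>\<open>convex\<close> and the Minkowski sum of \<^theory>\<open>HOL-Library.Set_Algebras\<close> apply.
\<close>

instantiation "fun" :: (type, real_vector) real_vector
begin

definition scaleR_fun :: "real \<Rightarrow> ('a \<Rightarrow> 'b) \<Rightarrow> 'a \<Rightarrow> 'b" where
  "scaleR_fun r f = (\<lambda>x. r *\<^sub>R f x)"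

instance
  by standard (simp_all add: scaleR_fun_def fun_eq_iff scaleR_add_right scaleR_add_left)

end

text \<open>
  Lebesgue measure on \<open>\<real>\<^sup>n\<close>, transported from the product measure, whose points are
  \<^const>\<open>undefined\<close> rather than \<open>0\<close> outside \<open>{..<n}\<close>, to a measure on all Borel sets of
  \<open>nat \<Rightarrow> real\<close> that is concentrated on \<^term>\<open>topspace (Euclidean_space n)\<close>.
\<close>

definition zero_extend :: "nat \<Rightarrow> (nat \<Rightarrow> real) \<Rightarrow> nat \<Rightarrow> real" where
  "zero_extend n x = (\<lambda>i. if i < n then x i else 0)"

definition Euclidean_lborel :: "nat \<Rightarrow> (nat \<Rightarrow> real) measure" where
  "Euclidean_lborel n = distr (\<Pi>\<^sub>M i\<in>{..<n}. lborel) borel (zero_extend n)"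

lemma measurable_zero_extend [measurable]:
  "zero_extend n \<in> (\<Pi>\<^sub>M i\<in>{..<n}. lborel) \<rightarrow>\<^sub>M borel"
proof -
  have "zero_extend n \<in> (\<Pi>\<^sub>M i\<in>{..<n}. lborel) \<rightarrow>\<^sub>M (\<Pi>\<^sub>M i\<in>UNIV. borel)"
  proof (rule measurable_PiM_single')
    fix i :: nat
    show "(\<lambda>x. zero_extend n x i) \<in> (\<Pi>\<^sub>M i\<in>{..<n}. lborel) \<rightarrow>\<^sub>M borel"
      by (cases "i < n") (simp_all add: zero_extend_def)
  qed auto
  then show ?thesis
    by (subst (asm) measurable_cong_sets[OF refl sets_PiM_equal_borel])
qed

lemma emeasure_Euclidean_lborel_box:
  fixes a b :: "nat \<Rightarrow> real"
  assumes "\<And>i. i < n \<Longrightarrow> a i \<le> b i"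
  shows "emeasure (Euclidean_lborel n)
    {x \<in> topspace (Euclidean_space n). \<forall>i<n. a i \<le> x i \<and> x i \<le> b i} = ennreal (\<Prod>i<n. b i - a i)"
proof -
  interpret product_sigma_finite "\<lambda>_. lborel :: real measure"
    by standard
  let ?B = "{x \<in> topspace (Euclidean_space n). \<forall>i<n. a i \<le> x i \<and> x i \<le> b i}"
  have "?B = PiE UNIV (\<lambda>i. if i < n then {a i..b i} else {0})"
  proof (rule set_eqI)
    fix x
    have "x \<in> PiE UNIV (\<lambda>i. if i < n then {a i..b i} else {0}) \<longleftrightarrow>
        (\<forall>i. (i < n \<longrightarrow> a i \<le> x i \<and> x i \<le> b i) \<and> (\<not> i < n \<longrightarrow> x i = 0))"
      by (simp add: PiE_iff)
    then show "x \<in> ?B \<longleftrightarrow> x \<in> PiE UNIV (\<lambda>i. if i < n then {a i..b i} else {0})"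
      unfolding topspace_Euclidean_space not_less by blast
  qed
  also have "\<dots> \<in> sets (\<Pi>\<^sub>M i\<in>UNIV. borel)"
    by (rule sets_PiM_I_countable) auto
  finally have "?B \<in> sets borel"
    unfolding sets_PiM_equal_borel .
  moreover have "zero_extend n -` ?B \<inter> space (\<Pi>\<^sub>M i\<in>{..<n}. lborel) = PiE {..<n} (\<lambda>i. {a i..b i})"
    unfolding zero_extend_def topspace_Euclidean_space space_PiM
    by (simp add: set_eq_iff PiE_iff Ball_def conj_commute)
  ultimately have "emeasure (Euclidean_lborel n) ?B =
      emeasure (\<Pi>\<^sub>M i\<in>{..<n}. lborel) (PiE {..<n} (\<lambda>i. {a i..b i}))"
    unfolding Euclidean_lborel_def by (simp only: emeasure_distr[OF measurable_zero_extend])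
  also have "\<dots> = (\<Prod>i<n. emeasure lborel {a i..b i})"
    by (rule emeasure_PiM) auto
  also have "\<dots> = (\<Prod>i<n. ennreal (b i - a i))"
    using assms by (intro prod.cong) auto
  also have "\<dots> = ennreal (\<Prod>i<n. b i - a i)"
    using assms by (intro prod_ennreal) auto
  finally show ?thesis .
qed

definition convex_body :: "nat \<Rightarrow> (nat \<Rightarrow> real) set \<Rightarrow> bool" where
  "convex_body n A \<longleftrightarrow>
     compactin (Euclidean_space n) A \<and> convex A \<and> Euclidean_space n interior_of A \<noteq> {}"

text \<open>\<open>- A\<close> would be the complement of \<open>A\<close>; the reflection of \<open>A\<close> is \<open>uminus ` A\<close>.\<close>

definition zero_symmetric :: "(nat \<Rightarrow> real) set \<Rightarrow> bool" where
  "zero_symmetric A \<longleftrightarrow> uminus ` A = A"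

definition positive_definite :: "nat \<Rightarrow> ((nat \<Rightarrow> real) \<Rightarrow> complex) \<Rightarrow> bool" where
  "positive_definite n f \<longleftrightarrow>
     continuous_map (Euclidean_space n) euclidean f \<and>
     (\<forall>Y c. finite Y \<and> Y \<subseteq> topspace (Euclidean_space n) \<longrightarrow>
        (\<Sum>a\<in>Y. \<Sum>b\<in>Y. c a * cnj (c b) * f (a - b)) \<in> \<real>\<^sub>\<ge>\<^sub>0)"

definition double_positive_definite :: "nat \<Rightarrow> ((nat \<Rightarrow> real) \<Rightarrow> real) \<Rightarrow> bool" where
  "double_positive_definite n f \<longleftrightarrow>
     positive_definite n (\<lambda>x. complex_of_real (f x)) \<and>
     (\<forall>x\<in>topspace (Euclidean_space n). 0 \<le> f x)"

definition vol :: "nat \<Rightarrow> (nat \<Rightarrow> real) set \<Rightarrow> real" where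
  "vol n A = measure (Euclidean_lborel n) A"

definition average :: "nat \<Rightarrow> (nat \<Rightarrow> real) set \<Rightarrow> ((nat \<Rightarrow> real) \<Rightarrow> real) \<Rightarrow> real" where
  "average n A f = 1 / vol n A * (LINT x:A|Euclidean_lborel n. f x)"

text \<open>
  The supremum is taken in \<^typ>\<open>ereal\<close>, so that an upper bound on it includes its finiteness.
  The denominator is positive for every admissible \<open>f\<close>, since \<open>f 0 > 0\<close> and \<open>0\<close> is an interior
  point of \<open>U\<close>.
\<close>

definition Cn :: "nat \<Rightarrow> (nat \<Rightarrow> real) set \<Rightarrow> (nat \<Rightarrow> real) set \<Rightarrow> ereal" where
  "Cn n U V =
     (SUP f \<in> {f. double_positive_definite n f \<and> (\<exists>x\<in>topspace (Euclidean_space n). f x \<noteq> 0)}.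
        ereal (average n V f / average n U f))"

end

theory Submission
  imports Defs
begin

text \<open>
  The quotient of averages is bounded by averaging a translation inequality over a set of
  translations.  Let \<open>W = U/2\<close> and let \<open>f\<close> be a double positive definite function.

  Positive definiteness, tested against the difference of the uniform mass on \<open>W\<close> and its translate
  by \<open>a\<close>, says that translating the argument cannot increase the mean over differences:
  \[\int_W \int_W f (x - y + a)\,dy\,dx \le \int_W \int_W f (x - y)\,dy\,dx\]
  (lemma \<open>integral_shift_le\<close>).  This is integrated over \<open>a \<in> V + U\<close> (lemma \<open>averaging\<close>).  On the right, \<open>x - y \<in> U\<close> by
  symmetry and convexity of \<open>U\<close>, so that the result is at most \<open>|V + U| |W| \<integral>\<^sub>U f\<close>.  On the left,
  the integral over \<open>a\<close> is taken first: for each \<open>x, y \<in> W\<close> the points \<open>x - y + a\<close> with \<open>a \<in> V + U\<close> run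
  through a set that contains \<open>V\<close>, and \<open>f \<ge> 0\<close>, so that the result is at least \<open>|W|\<^sup>2 \<integral>\<^sub>V f\<close>.
  Since \<open>|W| = |U| / 2 ^ n\<close>, it follows (lemma \<open>Cn_le\<close>) that
  \[C_n (U, V) \le 2 ^ n \frac{|V + U|}{|V|}.\]
  A discrete version of the argument would sum over the centres of a covering of \<open>V + U/2\<close> by
  translates of \<open>U/2\<close>, and the density of the covering would enter the bound, of order
  \<open>n ln n\<close> for the best known coverings by general convex bodies;
  a uniformly distributed family of centres covers with density \<open>1\<close>.  The factor
  \<open>n ln n + n ln (ln n) + n\<close> is at least \<open>1\<close> for every \<open>n \<ge> 2\<close> (lemma
  \<open>logarithmic_factor_ge_1\<close>), and so the theorem holds with \<open>\<epsilon> = 0\<close>.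
\<close>

section \<open>Euclidean space inside the space of sequences\<close>

lemma zero_extend_in_space [simp]: "zero_extend n x \<in> topspace (Euclidean_space n)"
  by (simp add: zero_extend_def topspace_Euclidean_space)

lemma zero_extend_id: "x \<in> topspace (Euclidean_space n) \<Longrightarrow> zero_extend n x = x"
  by (fastforce simp: zero_extend_def topspace_Euclidean_space)

lemma zero_extend_diff: "zero_extend n (x - y) = zero_extend n x - zero_extend n y"
  by (auto simp: zero_extend_def)

lemma zero_extend_uminus: "zero_extend n (- x) = - zero_extend n x"
  by (auto simp: zero_extend_def)

lemma Euclidean_space_add:
  "x \<in> topspace (Euclidean_space n) \<Longrightarrow> y \<in> topspace (Euclidean_space n) \<Longrightarrow>
    x + y \<in> topspace (Euclidean_space n)"
  by (simp add: topspace_Euclidean_space)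

lemma Euclidean_space_uminus:
  "x \<in> topspace (Euclidean_space n) \<Longrightarrow> - x \<in> topspace (Euclidean_space n)"
  by (simp add: topspace_Euclidean_space)

lemma Euclidean_space_diff:
  "x \<in> topspace (Euclidean_space n) \<Longrightarrow> y \<in> topspace (Euclidean_space n) \<Longrightarrow>
    x - y \<in> topspace (Euclidean_space n)"
  by (simp add: topspace_Euclidean_space)

lemma continuous_on_fun_add:
  fixes f g :: "'a::topological_space \<Rightarrow> nat \<Rightarrow> real"
  assumes "continuous_on S f" "continuous_on S g"
  shows "continuous_on S (\<lambda>x. f x + g x)"
proof (rule continuous_on_coordinatewise_then_product)
  show "continuous_on S (\<lambda>x. (f x + g x) i)" for i
    using assms[THEN continuous_on_product_then_coordinatewise, of i]
    by (simp add: continuous_on_add)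
qed

lemma continuous_on_fun_diff:
  fixes f g :: "'a::topological_space \<Rightarrow> nat \<Rightarrow> real"
  assumes "continuous_on S f" "continuous_on S g"
  shows "continuous_on S (\<lambda>x. f x - g x)"
proof (rule continuous_on_coordinatewise_then_product)
  show "continuous_on S (\<lambda>x. (f x - g x) i)" for i
    using assms[THEN continuous_on_product_then_coordinatewise, of i]
    by (simp add: continuous_on_diff)
qed

lemma continuous_on_fun_scaleR:
  fixes f :: "'a::topological_space \<Rightarrow> nat \<Rightarrow> real"
  assumes "continuous_on S f"
  shows "continuous_on S (\<lambda>x. c *\<^sub>R f x)"
proof (rule continuous_on_coordinatewise_then_product)
  show "continuous_on S (\<lambda>x. (c *\<^sub>R f x) i)" for i
    using assms[THEN continuous_on_product_then_coordinatewise, of i]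
    by (simp add: scaleR_fun_def continuous_on_mult_left)
qed

lemma continuous_on_zero_extend: "continuous_on UNIV (zero_extend n)"
proof (rule continuous_on_coordinatewise_then_product)
  show "continuous_on UNIV (\<lambda>x. zero_extend n x i)" for i
    by (cases "i < n") (simp_all add: zero_extend_def)
qed

lemma borel_measurable_fun_add [measurable (raw)]:
  fixes f g :: "'a \<Rightarrow> nat \<Rightarrow> real"
  assumes "f \<in> borel_measurable M" "g \<in> borel_measurable M"
  shows "(\<lambda>x. f x + g x) \<in> borel_measurable M"
  using assms
  by (rule borel_measurable_continuous_Pair)
     (intro continuous_on_fun_add continuous_on_fst continuous_on_snd continuous_on_id)

lemma borel_measurable_fun_diff [measurable (raw)]:
  fixes f g :: "'a \<Rightarrow> nat \<Rightarrow> real"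
  assumes "f \<in> borel_measurable M" "g \<in> borel_measurable M"
  shows "(\<lambda>x. f x - g x) \<in> borel_measurable M"
  using assms
  by (rule borel_measurable_continuous_Pair)
     (intro continuous_on_fun_diff continuous_on_fst continuous_on_snd continuous_on_id)

lemma borel_measurable_fun_scaleR [measurable (raw)]:
  fixes f :: "'a \<Rightarrow> nat \<Rightarrow> real"
  assumes "f \<in> borel_measurable M"
  shows "(\<lambda>x. c *\<^sub>R f x) \<in> borel_measurable M"
  using borel_measurable_continuous_onI[OF continuous_on_fun_scaleR[OF continuous_on_id]] assms
  by (rule measurable_compose_rev)

text \<open>The next lemma moves the hypotheses on bodies from the topology \<^const>\<open>Euclidean_space\<close> to the
  topology of the type, to which Borel sets and measurability refer.\<close>

lemma compactin_Euclidean_spaceD: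
  assumes "compactin (Euclidean_space n) A"
  shows "compact A" "A \<subseteq> topspace (Euclidean_space n)"
  using assms compactin_subset_topspace[OF assms]
  by (auto simp: Euclidean_space_def compactin_subtopology euclidean_product_topology)

section \<open>Lebesgue measure\<close>

lemma sets_Euclidean_lborel [simp, measurable_cong]: "sets (Euclidean_lborel n) = sets borel"
  by (simp add: Euclidean_lborel_def)

lemma space_Euclidean_lborel [simp]: "space (Euclidean_lborel n) = UNIV"
  by (simp add: Euclidean_lborel_def)

text \<open>The rescaled image of the product measure agrees with the product measure on rectangles, by the
  one-dimensional formula in each coordinate, and rectangles determine it.\<close>

lemma emeasure_PiM_lborel_affine:
  fixes a :: "nat \<Rightarrow> real"
  assumes c: "c > 0" and B: "B \<in> sets (\<Pi>\<^sub>M i\<in>{..<n}. lborel)"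
  shows "emeasure (\<Pi>\<^sub>M i\<in>{..<n}. lborel) B = ennreal (c ^ n) *
    emeasure (\<Pi>\<^sub>M i\<in>{..<n}. lborel)
      {x \<in> space (\<Pi>\<^sub>M i\<in>{..<n}. lborel). (\<lambda>i\<in>{..<n}. a i + c * x i) \<in> B}"
proof -
  interpret product_sigma_finite "\<lambda>_. lborel :: real measure"
    by standard
  let ?P = "\<Pi>\<^sub>M i\<in>{..<n}. (lborel :: real measure)"
  let ?S = "\<lambda>x. \<lambda>i\<in>{..<n}. a i + c * x i"
  have S [measurable]: "?S \<in> ?P \<rightarrow>\<^sub>M ?P"
    by (intro measurable_restrict) measurable
  have "density (distr ?P ?P ?S) (\<lambda>_. ennreal (c ^ n)) = ?P"
  proof (rule PiM_eqI)
    fix A :: "nat \<Rightarrow> real set"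
    assume A: "\<And>i. i \<in> {..<n} \<Longrightarrow> A i \<in> sets lborel"
    then have [measurable]: "PiE {..<n} A \<in> sets ?P"
      by (intro sets_PiM_I_finite) auto
    have one: "emeasure lborel (A i) = ennreal c * emeasure lborel {t. a i + c * t \<in> A i}"
      if "i \<in> {..<n}" for i
    proof -
      have [measurable]: "A i \<in> sets borel"
        using A[OF that] by simp
      have "emeasure lborel (A i) =
          emeasure (density (distr lborel borel (\<lambda>x. a i + c * x)) (\<lambda>_. ennreal (abs c))) (A i)"
        using c by (subst lborel_real_affine[of c "a i"]) auto
      also have "\<dots> = ennreal c * emeasure lborel {t. a i + c * t \<in> A i}"
        using c by (subst emeasure_density_const) (auto simp: emeasure_distr vimage_def)
      finally show ?thesis .
    qed
    have meas: "{t. a i + c * t \<in> A i} \<in> sets lborel" if "i \<in> {..<n}" for i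
    proof -
      have [measurable]: "A i \<in> sets borel"
        using A[OF that] by simp
      show ?thesis by measurable
    qed
    have "emeasure (density (distr ?P ?P ?S) (\<lambda>_. ennreal (c ^ n))) (PiE {..<n} A) =
        ennreal (c ^ n) * emeasure ?P (?S -` PiE {..<n} A \<inter> space ?P)"
      by (subst emeasure_density_const) (auto simp: emeasure_distr)
    also have "?S -` PiE {..<n} A \<inter> space ?P = PiE {..<n} (\<lambda>i. {t. a i + c * t \<in> A i})"
      unfolding set_eq_iff vimage_def Int_iff mem_Collect_eq space_PiM PiE_iff by auto
    also have "emeasure ?P \<dots> = (\<Prod>i<n. emeasure lborel {t. a i + c * t \<in> A i})"
      using meas by (intro emeasure_PiM) auto
    also have "ennreal (c ^ n) * \<dots> = (\<Prod>i<n. ennreal c * emeasure lborel {t. a i + c * t \<in> A i})"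
      using c by (simp add: prod.distrib ennreal_power)
    also have "\<dots> = (\<Prod>i\<in>{..<n}. emeasure lborel (A i))"
      using one by (intro prod.cong) auto
    finally show "emeasure (density (distr ?P ?P ?S) (\<lambda>_. ennreal (c ^ n))) (PiE {..<n} A) =
        (\<Prod>i\<in>{..<n}. emeasure lborel (A i))" .
  qed auto
  then have "emeasure ?P B = emeasure (density (distr ?P ?P ?S) (\<lambda>_. ennreal (c ^ n))) B"
    by simp
  also have "\<dots> = ennreal (c ^ n) * emeasure ?P {x \<in> space ?P. ?S x \<in> B}"
    using B by (subst emeasure_density_const) (auto simp: emeasure_distr vimage_def Int_def conj_commute)
  finally show ?thesis .
qed

lemma emeasure_Euclidean_lborel_affine:
  assumes c: "c > 0" and a: "a \<in> topspace (Euclidean_space n)" and B [measurable]: "B \<in> sets borel"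
  shows "emeasure (Euclidean_lborel n) B =
    ennreal (c ^ n) * emeasure (Euclidean_lborel n) {x. a + c *\<^sub>R x \<in> B}"
proof -
  let ?P = "\<Pi>\<^sub>M i\<in>{..<n}. (lborel :: real measure)"
  let ?S = "\<lambda>x. \<lambda>i\<in>{..<n}. a i + c * x i"
  have S: "zero_extend n (?S x) = a + c *\<^sub>R zero_extend n x" for x
    using a by (auto simp: zero_extend_def topspace_Euclidean_space scaleR_fun_def)
  have Smeas: "?S \<in> ?P \<rightarrow>\<^sub>M ?P"
    by (intro measurable_restrict) measurable
  have "emeasure (Euclidean_lborel n) B = emeasure ?P (zero_extend n -` B \<inter> space ?P)"
    unfolding Euclidean_lborel_def by (simp add: emeasure_distr)
  also have "\<dots> = ennreal (c ^ n) *
      emeasure ?P {x \<in> space ?P. ?S x \<in> zero_extend n -` B \<inter> space ?P}"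
    by (rule emeasure_PiM_lborel_affine[OF c]) measurable
  also have "{x \<in> space ?P. ?S x \<in> zero_extend n -` B \<inter> space ?P} =
      zero_extend n -` {x. a + c *\<^sub>R x \<in> B} \<inter> space ?P"
    using measurable_space[OF Smeas] by (auto simp: S)
  also have "emeasure ?P \<dots> = emeasure (Euclidean_lborel n) {x. a + c *\<^sub>R x \<in> B}"
    unfolding Euclidean_lborel_def by (subst emeasure_distr) (auto simp: vimage_def)
  finally show ?thesis .
qed

lemma nn_integral_Euclidean_lborel_shift:
  assumes a: "a \<in> topspace (Euclidean_space n)" and [measurable]: "g \<in> borel_measurable borel"
  shows "(\<integral>\<^sup>+x. g (a + x) \<partial>Euclidean_lborel n) = (\<integral>\<^sup>+x. g x \<partial>Euclidean_lborel n)"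
proof -
  have "distr (Euclidean_lborel n) borel (\<lambda>x. a + x) = Euclidean_lborel n"
  proof (rule measure_eqI)
    fix B assume "B \<in> sets (distr (Euclidean_lborel n) borel (\<lambda>x. a + x))"
    then have [measurable]: "B \<in> sets borel" by simp
    show "emeasure (distr (Euclidean_lborel n) borel (\<lambda>x. a + x)) B = emeasure (Euclidean_lborel n) B"
      using emeasure_Euclidean_lborel_affine[of 1 a n B] a by (simp add: emeasure_distr vimage_def)
  qed simp
  then have "(\<integral>\<^sup>+x. g x \<partial>Euclidean_lborel n) =
      (\<integral>\<^sup>+x. g x \<partial>distr (Euclidean_lborel n) borel (\<lambda>x. a + x))"
    by simp
  also have "\<dots> = (\<integral>\<^sup>+x. g (a + x) \<partial>Euclidean_lborel n)"
    by (rule nn_integral_distr) simp_all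
  finally show ?thesis by simp
qed

text \<open>Symmetric boxes bound all compact sets and exhaust the space, so their finite measure gives both
  finiteness on compact sets and \<open>\<sigma>\<close>-finiteness.\<close>

abbreviation Euclidean_box :: "nat \<Rightarrow> (nat \<Rightarrow> real) \<Rightarrow> (nat \<Rightarrow> real) set" where
  "Euclidean_box n b \<equiv> {x \<in> topspace (Euclidean_space n). \<forall>i<n. - b i \<le> x i \<and> x i \<le> b i}"

lemma closed_Euclidean_space: "closed (topspace (Euclidean_space n))"
  using closedin_Euclidean_space[of n] by (simp add: euclidean_product_topology)

lemma closed_Euclidean_box: "closed (Euclidean_box n b)"
proof -
  have "closed {x :: nat \<Rightarrow> real. \<forall>i<n. - b i \<le> x i \<and> x i \<le> b i}"
    by (intro closed_Collect_all closed_Collect_imp closed_Collect_conj closed_Collect_le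
        continuous_on_const continuous_on_product_coordinates open_Collect_const)
  then have "closed (topspace (Euclidean_space n) \<inter> {x. \<forall>i<n. - b i \<le> x i \<and> x i \<le> b i})"
    by (intro closed_Int closed_Euclidean_space)
  then show ?thesis
    by (simp add: Int_def)
qed

lemma emeasure_Euclidean_box_finite:
  assumes "\<And>i. b i \<ge> 0"
  shows "emeasure (Euclidean_lborel n) (Euclidean_box n b) < \<infinity>"
  using emeasure_Euclidean_lborel_box[of n "\<lambda>i. - b i" b] assms
  by (smt (verit) ennreal_less_top infinity_ennreal_def)

lemma emeasure_Euclidean_lborel_compact_finite:
  assumes "compact A" "A \<subseteq> topspace (Euclidean_space n)"
  shows "emeasure (Euclidean_lborel n) A < \<infinity>"
proof -
  have "\<exists>b\<ge>0. \<forall>x\<in>A. \<bar>x i\<bar> \<le> b" for i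
  proof -
    have "compact ((\<lambda>x. x i) ` A)"
      using assms(1) continuous_on_product_coordinates
      by (metis compact_continuous_image continuous_on_subset top_greatest)
    then obtain b where "\<forall>y\<in>(\<lambda>x. x i) ` A. norm y \<le> b"
      using compact_imp_bounded bounded_iff by metis
    then show ?thesis
      by (intro exI[of _ "max b 0"]) auto
  qed
  then obtain b where b: "\<And>i. b i \<ge> 0" "\<And>i x. x \<in> A \<Longrightarrow> \<bar>x i\<bar> \<le> b i"
    by metis
  have "A \<subseteq> Euclidean_box n b"
    using assms(2) b(2) by (auto simp: abs_le_iff minus_le_iff)
  then have "emeasure (Euclidean_lborel n) A \<le> emeasure (Euclidean_lborel n) (Euclidean_box n b)"
    by (rule emeasure_mono) (simp add: borel_closed closed_Euclidean_box)
  also have "\<dots> < \<infinity>"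
    using b(1) by (rule emeasure_Euclidean_box_finite)
  finally show ?thesis .
qed

lemma sigma_finite_Euclidean_lborel: "sigma_finite_measure (Euclidean_lborel n)"
proof
  let ?E = "topspace (Euclidean_space n)"
  (* The measure lives on all sequences; off Euclidean space it vanishes, so one null set suffices there. *)
  let ?A = "insert (- ?E) (range (\<lambda>k::nat. Euclidean_box n (\<lambda>_. real k)))"
  have E: "?E \<in> sets borel"
    by (simp add: borel_closed closed_Euclidean_space)
  have null: "emeasure (Euclidean_lborel n) (- ?E) = 0"
  proof -
    have "zero_extend n -` (- ?E) = {}"
      by auto
    then show ?thesis
      using E unfolding Euclidean_lborel_def by (subst emeasure_distr) auto
  qed
  have "x \<in> \<Union>?A" for x
  proof (cases "x \<in> ?E")
    case True
    obtain k :: nat where k: "(\<Sum>i<n. \<bar>x i\<bar>) \<le> real k"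
      using real_arch_simple by blast
    have "\<bar>x i\<bar> \<le> real k" if "i < n" for i
      using member_le_sum[of i "{..<n}" "\<lambda>i. \<bar>x i\<bar>"] that k by simp
    then have "x \<in> Euclidean_box n (\<lambda>_. real k)"
      using True by (auto simp: abs_le_iff minus_le_iff)
    then show ?thesis by blast
  qed simp
  then have "\<Union>?A = space (Euclidean_lborel n)"
    by auto
  moreover have "?A \<subseteq> sets (Euclidean_lborel n)"
    using E by (auto simp: borel_closed closed_Euclidean_box)
  moreover have "emeasure (Euclidean_lborel n) a \<noteq> \<infinity>" if "a \<in> ?A" for a
    using that null emeasure_Euclidean_box_finite[of "\<lambda>_. real _" n] by (auto simp: less_top)
  ultimately show "\<exists>A. countable A \<and> A \<subseteq> sets (Euclidean_lborel n) \<and> \<Union>A = space (Euclidean_lborel n) \<and>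
      (\<forall>a\<in>A. emeasure (Euclidean_lborel n) a \<noteq> \<infinity>)"
    by (intro exI[of _ ?A]) (auto simp del: Union_insert)
qed

section \<open>Positive definite functions\<close>

lemma sum_fibres:
  fixes c g :: "_ \<Rightarrow> real"
  assumes "finite I"
  shows "(\<Sum>i\<in>I. c i * g (q i)) = (\<Sum>a\<in>q ` I. (\<Sum>i\<in>{i \<in> I. q i = a}. c i) * g a)"
  by (subst sum.image_gen[OF assms, of _ q]) (auto simp: sum_distrib_right intro!: sum.cong)

locale double_pd_function =
  fixes n :: nat and f :: "(nat \<Rightarrow> real) \<Rightarrow> real"
  assumes dpd: "double_positive_definite n f"
begin

text \<open>Outside Euclidean space \<open>f\<close> is arbitrary, possibly not measurable.  \<open>F\<close> agrees with \<open>f\<close> on that space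
  and is a continuous positive definite function on the whole type.\<close>

definition F :: "(nat \<Rightarrow> real) \<Rightarrow> real" where
  "F x = f (zero_extend n x)"

lemma F_eq: "x \<in> topspace (Euclidean_space n) \<Longrightarrow> F x = f x"
  by (simp add: F_def zero_extend_id)

lemma F_nonneg: "0 \<le> F x"
  using dpd by (simp add: double_positive_definite_def F_def)

lemma continuous_F: "continuous_on UNIV F"
proof -
  have "continuous_map (Euclidean_space n) euclidean (\<lambda>x. complex_of_real (f x))"
    using dpd by (simp add: double_positive_definite_def positive_definite_def)
  then have "continuous_on (topspace (Euclidean_space n)) (\<lambda>x. complex_of_real (f x))"
    by (simp add: Euclidean_space_def euclidean_product_topology)
  then have "continuous_on (topspace (Euclidean_space n)) (\<lambda>x. Re (complex_of_real (f x)))"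
    by (rule continuous_on_Re)
  then have "continuous_on (topspace (Euclidean_space n)) f"
    by simp
  then have "continuous_on UNIV (\<lambda>x. f (zero_extend n x))"
    by (rule continuous_on_compose2[OF _ continuous_on_zero_extend]) auto
  then show ?thesis
    by (simp add: F_def[abs_def])
qed

lemma F_measurable [measurable]: "F \<in> borel_measurable borel"
  using continuous_F by (rule borel_measurable_continuous_onI)

text \<open>Positive definite functions are Hermitian, and \<open>f\<close> is real.  The form with coefficients \<open>1\<close> at \<open>0\<close>
  and \<open>\<i>\<close> at \<open>x\<close> has the value \<open>2 * f 0 + \<i> * (f x - f (- x))\<close>, whose imaginary part must vanish.\<close>

lemma F_even: "F (- x) = F x"
proof (cases "zero_extend n x = 0")
  case True
  then show ?thesis by (simp add: F_def zero_extend_uminus)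
next
  case False
  let ?z = "zero_extend n x"
  let ?c = "\<lambda>y. if y = ?z then \<i> else 1"
  have zero: "0 \<in> topspace (Euclidean_space n)"
    by (simp add: topspace_Euclidean_space)
  have "\<And>Y c. finite Y \<and> Y \<subseteq> topspace (Euclidean_space n) \<longrightarrow>
        (\<Sum>a\<in>Y. \<Sum>b\<in>Y. c a * cnj (c b) * complex_of_real (f (a - b))) \<in> \<real>\<^sub>\<ge>\<^sub>0"
    using dpd by (simp add: double_positive_definite_def positive_definite_def)
  from this[of "{0, ?z}" ?c] zero
  have "(\<Sum>a\<in>{0, ?z}. \<Sum>b\<in>{0, ?z}. ?c a * cnj (?c b) * complex_of_real (f (a - b))) \<in> \<real>\<^sub>\<ge>\<^sub>0"
    by simp
  then have "f (- ?z) = f ?z"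
    using False False[symmetric] by (simp add: complex_nonneg_Reals_iff)
  then show ?thesis by (simp add: F_def zero_extend_uminus)
qed

text \<open>Positive definiteness speaks of sets of points; here points of a family may coincide, which
  happens for a set together with a translate of it.  The coefficients of equal points add up.\<close>

lemma sum_family_nonneg:
  assumes "finite I"
  shows "0 \<le> (\<Sum>i\<in>I. \<Sum>j\<in>I. c i * c j * F (p i - p j))"
proof -
  define q where "q i = zero_extend n (p i)" for i
  define d where "d a = (\<Sum>i\<in>{i \<in> I. q i = a}. c i)" for a
  have pd: "\<And>Y c. finite Y \<and> Y \<subseteq> topspace (Euclidean_space n) \<longrightarrow>
        (\<Sum>a\<in>Y. \<Sum>b\<in>Y. c a * cnj (c b) * complex_of_real (f (a - b))) \<in> \<real>\<^sub>\<ge>\<^sub>0"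
    using dpd by (simp add: double_positive_definite_def positive_definite_def)
  have "finite (q ` I)" "q ` I \<subseteq> topspace (Euclidean_space n)"
    using assms by (auto simp: q_def)
  then have "(\<Sum>a\<in>q ` I. \<Sum>b\<in>q ` I. of_real (d a) * cnj (of_real (d b)) * complex_of_real (f (a - b)))
      \<in> \<real>\<^sub>\<ge>\<^sub>0"
    by (intro pd[THEN mp] conjI)
  also have "(\<Sum>a\<in>q ` I. \<Sum>b\<in>q ` I. of_real (d a) * cnj (of_real (d b)) * complex_of_real (f (a - b)))
      = of_real (\<Sum>a\<in>q ` I. \<Sum>b\<in>q ` I. d a * d b * f (a - b))"
    by simp
  finally have "0 \<le> (\<Sum>a\<in>q ` I. \<Sum>b\<in>q ` I. d a * d b * f (a - b))"
    by (simp only: nonneg_Reals_of_real_iff)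
  also have "\<dots> = (\<Sum>a\<in>q ` I. d a * (\<Sum>b\<in>q ` I. d b * f (a - b)))"
    by (simp add: sum_distrib_left mult.assoc)
  also have "\<dots> = (\<Sum>i\<in>I. c i * (\<Sum>b\<in>q ` I. d b * f (q i - b)))"
    unfolding d_def by (rule sum_fibres[OF assms, symmetric])
  also have "\<dots> = (\<Sum>i\<in>I. c i * (\<Sum>j\<in>I. c j * f (q i - q j)))"
    unfolding d_def using sum_fibres[OF assms, of c "\<lambda>b. f (_ - b)" q] by simp
  also have "\<dots> = (\<Sum>i\<in>I. \<Sum>j\<in>I. c i * c j * F (p i - p j))"
    by (simp add: sum_distrib_left mult.assoc F_def zero_extend_diff q_def)
  finally show ?thesis .
qed

text \<open>Coefficients \<open>1\<close> at \<open>x\<close> and \<open>-1\<close> at \<open>0\<close> give \<open>2 * F 0 - F x - F (- x) \<ge> 0\<close>.  The bound makes \<open>F\<close>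
  integrable over sets of finite measure and provides the majorant in the limit below.\<close>

lemma F_le: "F x \<le> F 0"
proof -
  have "0 \<le> (\<Sum>i\<in>(UNIV::bool set). \<Sum>j\<in>UNIV. (if i then 1 else -1) * (if j then 1 else -1) *
      F ((if i then x else 0) - (if j then x else 0)))"
    by (rule sum_family_nonneg) simp
  then show ?thesis
    using F_even[of x] by (simp add: UNIV_bool)
qed

text \<open>The form is nonnegative for the signed masses \<open>m\<close> on \<open>P + a\<close> and \<open>- m\<close> on \<open>P\<close>.  The two diagonal
  blocks are equal by translation invariance and the two mixed blocks are equal by evenness.\<close>

lemma finite_shift_le:
  assumes "finite P"
  shows "(\<Sum>x\<in>P. \<Sum>y\<in>P. m x * m y * F (x - y + a)) \<le> (\<Sum>x\<in>P. \<Sum>y\<in>P. m x * m y * F (x - y))"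
proof -
  let ?c = "\<lambda>(b, x). if b then m x else - m x"
  let ?p = "\<lambda>(b, x). if b then x + a else x"
  have swap: "(\<Sum>x\<in>P. \<Sum>y\<in>P. m x * m y * F (x - (y + a))) = (\<Sum>x\<in>P. \<Sum>y\<in>P. m x * m y * F (x - y + a))"
  proof -
    have "F (x - (y + a)) = F (y - x + a)" for x y
      using F_even[of "x - (y + a)"] by (simp add: algebra_simps)
    then show ?thesis
      by (subst sum.swap) (simp add: mult.commute mult.left_commute)
  qed
  have split: "(\<Sum>i\<in>UNIV \<times> P. g i) = (\<Sum>x\<in>P. g (True, x)) + (\<Sum>x\<in>P. g (False, x))"
    for g :: "bool \<times> (nat \<Rightarrow> real) \<Rightarrow> real"
    using sum.cartesian_product[of "\<lambda>b x. g (b, x)" P UNIV] by (simp add: UNIV_bool)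
  have e: "x + a - (y + a) = x - y" "x + a - y = x - y + a" for x y :: "nat \<Rightarrow> real"
    by (simp_all add: algebra_simps)
  have "0 \<le> (\<Sum>i\<in>UNIV \<times> P. \<Sum>j\<in>UNIV \<times> P. ?c i * ?c j * F (?p i - ?p j))"
    using assms by (intro sum_family_nonneg) simp
  also have "\<dots> = 2 * (\<Sum>x\<in>P. \<Sum>y\<in>P. m x * m y * F (x - y))
      - (\<Sum>x\<in>P. \<Sum>y\<in>P. m x * m y * F (x - y + a)) - (\<Sum>x\<in>P. \<Sum>y\<in>P. m x * m y * F (x - (y + a)))"
    by (simp add: split e sum.distrib sum_negf sum_subtractf)
  finally show ?thesis
    unfolding swap by simp
qed

end

text \<open>A simple function discretises a measure: integrals of its values against the product measure are
  double sums of the kind that positive definiteness controls.\<close>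

lemma integral_pair_simple:
  fixes h :: "'b \<Rightarrow> 'b \<Rightarrow> real"
  assumes "finite_measure M" and s: "simple_function M s"
  shows "(\<integral>z. h (s (fst z)) (s (snd z)) \<partial>(M \<Otimes>\<^sub>M M)) =
    (\<Sum>p\<in>s ` space M. \<Sum>q\<in>s ` space M.
      measure M (s -` {p} \<inter> space M) * measure M (s -` {q} \<inter> space M) * h p q)"
proof -
  interpret finite_measure M by fact
  interpret P: pair_sigma_finite M M ..
  let ?A = "\<lambda>p. s -` {p} \<inter> space M"
  have fin: "finite (s ` space M)"
    using s by (simp add: simple_function_def)
  have A: "?A p \<in> sets M" for p
    using s by (rule simple_functionD(2))
  have prod: "emeasure (M \<Otimes>\<^sub>M M) (?A p \<times> ?A q) = ennreal (measure M (?A p) * measure M (?A q))" for p q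
    using A by (simp add: emeasure_pair_measure_Times emeasure_eq_measure ennreal_mult)
  have "(\<integral>z. h (s (fst z)) (s (snd z)) \<partial>(M \<Otimes>\<^sub>M M)) =
      (\<integral>z. (\<Sum>p\<in>s ` space M. \<Sum>q\<in>s ` space M. h p q * indicator (?A p \<times> ?A q) z) \<partial>(M \<Otimes>\<^sub>M M))"
  proof (rule Bochner_Integration.integral_cong[OF refl])
    fix z assume "z \<in> space (M \<Otimes>\<^sub>M M)"
    then have z: "fst z \<in> space M" "snd z \<in> space M"
      by (auto simp: space_pair_measure)
    have "(\<Sum>p\<in>s ` space M. \<Sum>q\<in>s ` space M. h p q * indicator (?A p \<times> ?A q) z) =
        (\<Sum>p\<in>s ` space M. \<Sum>q\<in>s ` space M.
          if s (fst z) = p then if s (snd z) = q then h p q else 0 else 0)"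
      using z by (intro sum.cong refl) (auto simp: indicator_def mem_Times_iff)
    also have "\<dots> = (\<Sum>p\<in>s ` space M. if s (fst z) = p then h p (s (snd z)) else 0)"
      using z fin by (intro sum.cong refl) (auto simp: sum.delta)
    also have "\<dots> = h (s (fst z)) (s (snd z))"
      using z fin by (auto simp: sum.delta)
    finally show "h (s (fst z)) (s (snd z)) =
        (\<Sum>p\<in>s ` space M. \<Sum>q\<in>s ` space M. h p q * indicator (?A p \<times> ?A q) z)" ..
  qed
  also have "\<dots> = (\<Sum>p\<in>s ` space M. \<Sum>q\<in>s ` space M. h p q * measure (M \<Otimes>\<^sub>M M) (?A p \<times> ?A q))"
    using A prod by (simp add: integrable_real_indicator)
  also have "\<dots> = (\<Sum>p\<in>s ` space M. \<Sum>q\<in>s ` space M. measure M (?A p) * measure M (?A q) * h p q)"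
    by (simp add: measure_def prod mult.commute)
  finally show ?thesis .
qed

context double_pd_function
begin

text \<open>Simple functions that converge to the identity turn the finite inequality into one between
  integrals, since \<open>F\<close> is continuous and bounded.\<close>

lemma integral_shift_le:
  assumes "finite_measure M" and sets [measurable_cong]: "sets M = sets borel"
  shows "(\<integral>z. F (fst z - snd z + a) \<partial>(M \<Otimes>\<^sub>M M)) \<le> (\<integral>z. F (fst z - snd z) \<partial>(M \<Otimes>\<^sub>M M))"
proof -
  interpret M: finite_measure M by fact
  interpret P: pair_sigma_finite M M ..
  interpret P': finite_measure "M \<Otimes>\<^sub>M M"
    by (intro finite_measure_pair_measure assms)
  have ident: "(\<lambda>x. x) \<in> borel_measurable M"
    by (simp add: sets measurable_ident_sets)
  obtain s where s: "\<And>k. simple_function M (s k)" "\<And>x. x \<in> space M \<Longrightarrow> (\<lambda>k. s k x) \<longlonglongrightarrow> x"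
    using borel_measurable_implies_sequence_metric[OF ident, of undefined] by auto
  have [measurable]: "s k \<in> borel_measurable M" for k
    using s(1) by (rule borel_measurable_simple_function)
  have lim: "(\<lambda>k. \<integral>z. F (s k (fst z) - s k (snd z) + b) \<partial>(M \<Otimes>\<^sub>M M))
      \<longlonglongrightarrow> (\<integral>z. F (fst z - snd z + b) \<partial>(M \<Otimes>\<^sub>M M))" for b
  proof (rule integral_dominated_convergence)
    show "integrable (M \<Otimes>\<^sub>M M) (\<lambda>_. F 0)" by simp
    show "AE z in M \<Otimes>\<^sub>M M. (\<lambda>k. F (s k (fst z) - s k (snd z) + b)) \<longlonglongrightarrow> F (fst z - snd z + b)"
    proof (rule AE_I2)
      fix z assume "z \<in> space (M \<Otimes>\<^sub>M M)"
      then have "(\<lambda>k. (s k (fst z), s k (snd z))) \<longlonglongrightarrow> (fst z, snd z)"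
        by (intro tendsto_Pair s(2)) (auto simp: space_pair_measure)
      moreover have "continuous_on UNIV (\<lambda>z. F (fst z - snd z + b))"
        by (rule continuous_on_compose2[OF continuous_F])
           (auto intro!: continuous_on_fun_add continuous_on_fun_diff continuous_on_const
              continuous_on_fst continuous_on_snd continuous_on_id)
      ultimately show "(\<lambda>k. F (s k (fst z) - s k (snd z) + b)) \<longlonglongrightarrow> F (fst z - snd z + b)"
        using continuous_on_tendsto_compose[of UNIV "\<lambda>z. F (fst z - snd z + b)"] by fastforce
    qed
    show "AE z in M \<Otimes>\<^sub>M M. norm (F (s k (fst z) - s k (snd z) + b)) \<le> F 0" for k
      using F_nonneg F_le by simp
  qed measurable
  show ?thesis
  proof (rule LIMSEQ_le[OF lim])
    show "(\<lambda>k. \<integral>z. F (s k (fst z) - s k (snd z)) \<partial>(M \<Otimes>\<^sub>M M))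
      \<longlonglongrightarrow> (\<integral>z. F (fst z - snd z) \<partial>(M \<Otimes>\<^sub>M M))"
      using lim[of 0] by (simp only: add_0_right)
    have "(\<integral>z. F (s k (fst z) - s k (snd z) + a) \<partial>(M \<Otimes>\<^sub>M M))
        \<le> (\<integral>z. F (s k (fst z) - s k (snd z)) \<partial>(M \<Otimes>\<^sub>M M))" for k
      unfolding integral_pair_simple[OF assms(1) s(1), of "\<lambda>x y. F (x - y + a)"]
        integral_pair_simple[OF assms(1) s(1), of "\<lambda>x y. F (x - y)"]
      by (rule finite_shift_le[OF simple_functionD(1)[OF s(1)]])
    then show "\<exists>N. \<forall>k\<ge>N. (\<integral>z. F (s k (fst z) - s k (snd z) + a) \<partial>(M \<Otimes>\<^sub>M M))
        \<le> (\<integral>z. F (s k (fst z) - s k (snd z)) \<partial>(M \<Otimes>\<^sub>M M))"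
      by blast
  qed
qed

lemma nn_integral_shift_le:
  assumes "finite_measure M" and sets [measurable_cong]: "sets M = sets borel"
  shows "(\<integral>\<^sup>+x. \<integral>\<^sup>+y. F (x - y + a) \<partial>M \<partial>M) \<le> (\<integral>\<^sup>+x. \<integral>\<^sup>+y. F (x - y) \<partial>M \<partial>M)"
proof -
  interpret M: finite_measure M by fact
  interpret P: finite_measure "M \<Otimes>\<^sub>M M"
    by (intro finite_measure_pair_measure assms)
  have eq: "(\<integral>\<^sup>+x. \<integral>\<^sup>+y. F (x - y + b) \<partial>M \<partial>M) = ennreal (\<integral>z. F (fst z - snd z + b) \<partial>(M \<Otimes>\<^sub>M M))" for b
  proof -
    have "(\<integral>\<^sup>+x. \<integral>\<^sup>+y. F (x - y + b) \<partial>M \<partial>M) = (\<integral>\<^sup>+z. F (fst z - snd z + b) \<partial>(M \<Otimes>\<^sub>M M))"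
      by (subst M.nn_integral_fst[symmetric]) simp_all
    also have "\<dots> = ennreal (\<integral>z. F (fst z - snd z + b) \<partial>(M \<Otimes>\<^sub>M M))"
      using F_nonneg F_le by (intro nn_integral_eq_integral P.integrable_const_bound[of _ "F 0"]) auto
    finally show ?thesis .
  qed
  show ?thesis
    using eq[of a] eq[of 0] integral_shift_le[OF assms, of a] by (simp add: ennreal_leI)
qed

end

section \<open>The comparison of averages\<close>

text \<open>This is the translation inequality for the uniform measure on \<open>W\<close>, integrated over the
  translations in \<open>A\<close>.  The two set hypotheses say that differences of points of \<open>W\<close> stay in \<open>U\<close> and
  that \<open>A\<close> contains every translation that these differences need to reach \<open>V\<close>.  The factor
  \<open>emeasure W\<close> stays on both sides because it can be cancelled only if it is nonzero.\<close>

lemma (in double_pd_function) averaging: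
  assumes [measurable]: "W \<in> sets borel" "A \<in> sets borel" "V \<in> sets borel" "U \<in> sets borel"
    and W: "W \<subseteq> topspace (Euclidean_space n)" "emeasure (Euclidean_lborel n) W < \<infinity>"
    and U: "\<And>x y. x \<in> W \<Longrightarrow> y \<in> W \<Longrightarrow> x - y \<in> U"
    and A: "\<And>x y z. x \<in> W \<Longrightarrow> y \<in> W \<Longrightarrow> z \<in> V \<Longrightarrow> z - (x - y) \<in> A"
  shows "emeasure (Euclidean_lborel n) W * (emeasure (Euclidean_lborel n) W *
      (\<integral>\<^sup>+z. indicator V z * ennreal (F z) \<partial>Euclidean_lborel n)) \<le>
    emeasure (Euclidean_lborel n) A * (emeasure (Euclidean_lborel n) W *
      (\<integral>\<^sup>+z. indicator U z * ennreal (F z) \<partial>Euclidean_lborel n))"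
proof -
  let ?L = "Euclidean_lborel n" and ?E = "topspace (Euclidean_space n)"
  define M where "M = density ?L (indicator W)"
  have sets_M [simp, measurable_cong]: "sets M = sets borel"
    by (simp add: M_def)
  have M_space: "emeasure M (space M) = emeasure ?L W"
    by (simp add: M_def emeasure_density)
  have finM: "finite_measure M"
    using M_space W(2) by (intro finite_measureI) simp
  interpret M: finite_measure M by (rule finM)
  interpret L: sigma_finite_measure ?L by (rule sigma_finite_Euclidean_lborel)
  interpret M_L: pair_sigma_finite M ?L ..
  have AE_M: "AE x in M. x \<in> W"
    unfolding M_def by (subst AE_density) (auto simp: indicator_def)
  have diff_space: "x - y \<in> ?E" if "x \<in> W" "y \<in> W" for x y
    using that W(1) by (auto intro: Euclidean_space_diff)

  have V: "(\<integral>\<^sup>+z. indicator V z * ennreal (F z) \<partial>?L) \<le> (\<integral>\<^sup>+a. indicator A a * ennreal (F (x - y + a)) \<partial>?L)"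
    if xy: "x \<in> W" "y \<in> W" for x y
  proof -
    have "(\<integral>\<^sup>+z. indicator V z * ennreal (F z) \<partial>?L) \<le> (\<integral>\<^sup>+z. indicator A (z - (x - y)) * ennreal (F z) \<partial>?L)"
      using A[OF xy] by (intro nn_integral_mono) (auto simp: indicator_def)
    also have "\<dots> = (\<integral>\<^sup>+a. indicator A ((x - y + a) - (x - y)) * ennreal (F (x - y + a)) \<partial>?L)"
      by (rule nn_integral_Euclidean_lborel_shift[OF diff_space[OF xy], symmetric]) measurable
    finally show ?thesis
      by simp
  qed
  have "emeasure ?L W * (emeasure ?L W * (\<integral>\<^sup>+z. indicator V z * ennreal (F z) \<partial>?L)) =
      (\<integral>\<^sup>+x. \<integral>\<^sup>+y. (\<integral>\<^sup>+z. indicator V z * ennreal (F z) \<partial>?L) \<partial>M \<partial>M)"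
    by (simp add: M_space mult.commute mult.left_commute)
  also have "\<dots> \<le> (\<integral>\<^sup>+x. \<integral>\<^sup>+y. \<integral>\<^sup>+a. indicator A a * ennreal (F (x - y + a)) \<partial>?L \<partial>M \<partial>M)"
  proof (rule nn_integral_mono_AE, rule eventually_mono[OF AE_M])
    fix x assume x: "x \<in> W"
    show "(\<integral>\<^sup>+y. (\<integral>\<^sup>+z. indicator V z * ennreal (F z) \<partial>?L) \<partial>M) \<le>
        (\<integral>\<^sup>+y. \<integral>\<^sup>+a. indicator A a * ennreal (F (x - y + a)) \<partial>?L \<partial>M)"
      by (rule nn_integral_mono_AE, rule eventually_mono[OF AE_M], rule V[OF x])
  qed
  also have "\<dots> = (\<integral>\<^sup>+x. \<integral>\<^sup>+a. \<integral>\<^sup>+y. indicator A a * ennreal (F (x - y + a)) \<partial>M \<partial>?L \<partial>M)"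
    by (rule nn_integral_cong, rule M_L.Fubini'[symmetric]) measurable
  also have "\<dots> = (\<integral>\<^sup>+a. \<integral>\<^sup>+x. \<integral>\<^sup>+y. indicator A a * ennreal (F (x - y + a)) \<partial>M \<partial>M \<partial>?L)"
    by (rule M_L.Fubini'[symmetric]) measurable
  also have "\<dots> = (\<integral>\<^sup>+a. indicator A a * (\<integral>\<^sup>+x. \<integral>\<^sup>+y. F (x - y + a) \<partial>M \<partial>M) \<partial>?L)"
    by (simp add: nn_integral_cmult)
  also have "\<dots> \<le> (\<integral>\<^sup>+a. indicator A a * (\<integral>\<^sup>+x. \<integral>\<^sup>+y. F (x - y) \<partial>M \<partial>M) \<partial>?L)"
    by (intro nn_integral_mono mult_left_mono nn_integral_shift_le finM) simp_all
  also have "\<dots> = emeasure ?L A * (\<integral>\<^sup>+x. \<integral>\<^sup>+y. F (x - y) \<partial>M \<partial>M)"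
    by (simp add: nn_integral_multc)
  also have "(\<integral>\<^sup>+x. \<integral>\<^sup>+y. F (x - y) \<partial>M \<partial>M) \<le>
      (\<integral>\<^sup>+x. (\<integral>\<^sup>+z. indicator U z * ennreal (F z) \<partial>?L) \<partial>M)"
  proof (rule nn_integral_mono_AE, rule eventually_mono[OF AE_M])
    fix x assume x: "x \<in> W"
    have "(\<integral>\<^sup>+y. F (x - y) \<partial>M) = (\<integral>\<^sup>+y. indicator W y * ennreal (F (x - y)) \<partial>?L)"
      by (simp add: M_def nn_integral_density)
    also have "\<dots> \<le> (\<integral>\<^sup>+y. indicator U (- x + y) * ennreal (F (- x + y)) \<partial>?L)"
    proof (rule nn_integral_mono)
      fix y
      show "indicator W y * ennreal (F (x - y)) \<le> indicator U (- x + y) * ennreal (F (- x + y))"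
        using U[OF _ x, of y] F_even[of "x - y"] by (auto simp: indicator_def)
    qed
    also have "\<dots> = (\<integral>\<^sup>+z. indicator U z * ennreal (F z) \<partial>?L)"
    proof (rule nn_integral_Euclidean_lborel_shift)
      show "- x \<in> ?E"
        using x W(1) by (auto intro: Euclidean_space_uminus)
    qed measurable
    finally show "(\<integral>\<^sup>+y. F (x - y) \<partial>M) \<le> (\<integral>\<^sup>+z. indicator U z * ennreal (F z) \<partial>?L)" .
  qed
  also have "(\<integral>\<^sup>+x. (\<integral>\<^sup>+z. indicator U z * ennreal (F z) \<partial>?L) \<partial>M) =
      emeasure ?L W * (\<integral>\<^sup>+z. indicator U z * ennreal (F z) \<partial>?L)"
    by (simp add: M_space mult.commute)
  finally show ?thesis
    by (simp add: mult_left_mono)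
qed

lemma (in double_pd_function) nn_integral_set_eq:
  assumes "compact A" "A \<subseteq> topspace (Euclidean_space n)"
  shows "(\<integral>\<^sup>+z. indicator A z * ennreal (F z) \<partial>Euclidean_lborel n) = ennreal (LINT x:A|Euclidean_lborel n. f x)"
    and "0 \<le> (LINT x:A|Euclidean_lborel n. f x)"
proof -
  let ?L = "Euclidean_lborel n"
  have A [measurable]: "A \<in> sets borel"
    using assms(1) by (simp add: borel_closed compact_imp_closed)
  have eq: "(LINT x:A|?L. f x) = (LINT x|?L. indicator A x * F x)"
    unfolding set_lebesgue_integral_def
    using assms(2) by (intro Bochner_Integration.integral_cong) (auto simp: indicator_def F_eq subset_iff)
  have "integrable ?L (\<lambda>x. indicator A x * F x)"
  proof (rule Bochner_Integration.integrable_bound)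
    show "integrable ?L (\<lambda>x. indicator A x * F 0)"
      using emeasure_Euclidean_lborel_compact_finite[OF assms]
      by (intro integrable_mult_left) (simp add: integrable_real_indicator)
    show "AE x in ?L. norm (indicator A x * F x) \<le> norm (indicator A x * F 0)"
      using F_le F_nonneg by (auto simp: indicator_def)
  qed measurable
  then have "(\<integral>\<^sup>+z. ennreal (indicator A z * F z) \<partial>?L) = ennreal (LINT x|?L. indicator A x * F x)"
    using F_nonneg by (intro nn_integral_eq_integral) (auto simp: indicator_def)
  also have "(\<integral>\<^sup>+z. ennreal (indicator A z * F z) \<partial>?L) = (\<integral>\<^sup>+z. indicator A z * ennreal (F z) \<partial>?L)"
    by (intro nn_integral_cong) (auto simp: indicator_def)
  finally show "(\<integral>\<^sup>+z. indicator A z * ennreal (F z) \<partial>?L) = ennreal (LINT x:A|?L. f x)"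
    unfolding eq .
  show "0 \<le> (LINT x:A|?L. f x)"
    unfolding eq using F_nonneg by (intro integral_nonneg_AE) (auto simp: indicator_def)
qed

lemma compact_set_plus:
  fixes U V :: "(nat \<Rightarrow> real) set"
  assumes "compact U" "compact V"
  shows "compact (V + U)"
proof -
  have "compact ((\<lambda>p. fst p + snd p) ` (V \<times> U))"
    using assms
    by (intro compact_continuous_image compact_Times continuous_on_fun_add
        continuous_on_fst continuous_on_snd continuous_on_id)
  then show ?thesis
    by (simp add: set_plus_image split_def)
qed

lemma emeasure_eq_vol:
  assumes "compact A" "A \<subseteq> topspace (Euclidean_space n)"
  shows "emeasure (Euclidean_lborel n) A = ennreal (vol n A)"
  unfolding vol_def
  using emeasure_Euclidean_lborel_compact_finite[OF assms] by (simp add: emeasure_eq_ennreal_measure)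

text \<open>The previous lemma applies with \<open>W = U/2\<close> and \<open>A = V + U\<close>: a difference of two points of \<open>U/2\<close> is a
  midpoint of two points of \<open>U\<close>.  The halving costs the factor \<open>2 ^ n\<close>.\<close>

lemma (in double_pd_function) integral_comparison:
  assumes U: "compactin (Euclidean_space n) U" "convex U" "zero_symmetric U"
    and V: "compactin (Euclidean_space n) V"
  shows "vol n U * (LINT x:V|Euclidean_lborel n. f x) \<le>
    2 ^ n * vol n (V + U) * (LINT x:U|Euclidean_lborel n. f x)"
proof (cases "vol n U = 0")
  case True
  then show ?thesis
    using nn_integral_set_eq(2) compactin_Euclidean_spaceD[OF U(1)] by (simp add: vol_def)
next
  case False
  let ?L = "Euclidean_lborel n" and ?E = "topspace (Euclidean_space n)"
  note U' = compactin_Euclidean_spaceD[OF U(1)] and V' = compactin_Euclidean_spaceD[OF V]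
  have A': "compact (V + U)" "V + U \<subseteq> ?E"
    using compact_set_plus[OF U'(1) V'(1)] U'(2) V'(2)
    by (auto elim!: set_plus_elim intro!: Euclidean_space_add)
  have [measurable]: "U \<in> sets borel" "V \<in> sets borel" "V + U \<in> sets borel"
    using U' V' A' by (auto simp: borel_closed compact_imp_closed)
  define W where "W = {x. 2 *\<^sub>R x \<in> U}"
  have [measurable]: "W \<in> sets borel"
    unfolding W_def by measurable
  have "emeasure ?L U = ennreal (2 ^ n) * emeasure ?L {x. 0 + 2 *\<^sub>R x \<in> U}"
    by (rule emeasure_Euclidean_lborel_affine) (simp_all add: topspace_Euclidean_space)
  then have LU: "ennreal (vol n U) = ennreal (2 ^ n) * emeasure ?L W"
    using emeasure_eq_vol[OF U'] by (simp add: W_def)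
  then have Wfin: "emeasure ?L W \<noteq> \<infinity>"
    by (auto simp: ennreal_mult_top)
  then have LW: "emeasure ?L W = ennreal (vol n W)"
    by (simp add: vol_def emeasure_eq_ennreal_measure)
  have volW: "vol n U = 2 ^ n * vol n W"
    using LU unfolding LW by (simp add: ennreal_mult[symmetric] vol_def)
  then have "vol n W \<noteq> 0"
    using False by auto
  then have Wpos: "vol n W > 0"
    unfolding vol_def by (simp add: zero_less_measure_iff)
  have diff: "x - y \<in> U" if "x \<in> W" "y \<in> W" for x y
  proof -
    have "- (2 *\<^sub>R y) \<in> U"
      using that(2) U(3) by (auto simp: W_def zero_symmetric_def)
    then have "(1/2) *\<^sub>R (2 *\<^sub>R x) + (1/2) *\<^sub>R (- (2 *\<^sub>R y)) \<in> U"
      using that(1) by (intro convexD[OF U(2)]) (auto simp: W_def)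
    then show ?thesis by simp
  qed
  have "emeasure ?L W * (emeasure ?L W * (\<integral>\<^sup>+z. indicator V z * ennreal (F z) \<partial>?L)) \<le>
    emeasure ?L (V + U) * (emeasure ?L W * (\<integral>\<^sup>+z. indicator U z * ennreal (F z) \<partial>?L))"
  proof (rule averaging)
    show "W \<subseteq> ?E"
      using U'(2) by (auto simp: W_def topspace_Euclidean_space scaleR_fun_def subset_iff)
    show "emeasure ?L W < \<infinity>"
      using Wfin by (simp add: less_top)
    show "z - (x - y) \<in> V + U" if "x \<in> W" "y \<in> W" "z \<in> V" for x y z
      using set_plus_intro[OF that(3) diff[OF that(2,1)]] by (simp add: algebra_simps)
  qed (simp_all add: diff)
  then have "ennreal (vol n W * (vol n W * (LINT x:V|?L. f x))) \<le>
      ennreal (vol n (V + U) * (vol n W * (LINT x:U|?L. f x)))"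
    unfolding LW emeasure_eq_vol[OF A'] nn_integral_set_eq(1)[OF U'] nn_integral_set_eq(1)[OF V']
    using nn_integral_set_eq(2)[OF U'] nn_integral_set_eq(2)[OF V']
    by (simp add: ennreal_mult[symmetric] vol_def)
  then have "vol n W * (vol n W * (LINT x:V|?L. f x)) \<le> vol n W * (vol n (V + U) * (LINT x:U|?L. f x))"
    using nn_integral_set_eq(2)[OF U'] by (simp add: vol_def mult.left_commute)
  then have "vol n W * (LINT x:V|?L. f x) \<le> vol n (V + U) * (LINT x:U|?L. f x)"
    using Wpos by simp
  then show ?thesis
    unfolding volW by simp
qed

lemma Cn_le:
  assumes U: "compactin (Euclidean_space n) U" "convex U" "zero_symmetric U"
    and V: "compactin (Euclidean_space n) V"
  shows "Cn n U V \<le> ereal (2 ^ n * (vol n (V + U) / vol n V))"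
  unfolding Cn_def
proof (rule SUP_least)
  fix f
  assume "f \<in> {f. double_positive_definite n f \<and> (\<exists>x\<in>topspace (Euclidean_space n). f x \<noteq> 0)}"
  then interpret double_pd_function n f
    by unfold_locales simp
  let ?I = "\<lambda>A. LINT x:A|Euclidean_lborel n. f x"
  have vol_nonneg: "vol n A \<ge> 0" for A
    by (simp add: vol_def)
  note cmp = integral_comparison[OF U V]
  have "average n V f / average n U f = vol n U * ?I V / (vol n V * ?I U)"
    by (simp add: average_def)
  also have "\<dots> \<le> 2 ^ n * (vol n (V + U) / vol n V)"
  (* If a denominator vanishes, the quotient on the left is 0 by the convention x / 0 = 0. *)
  proof (cases "vol n V = 0 \<or> ?I U = 0")
    case False
    then have "vol n V > 0" "?I U > 0"
      using vol_nonneg[of V] nn_integral_set_eq(2) compactin_Euclidean_spaceD[OF U(1)]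
      by (auto simp: less_le)
    then show ?thesis
      using cmp by (simp add: field_simps)
  qed (auto simp: vol_nonneg)
  finally show "ereal (average n V f / average n U f) \<le> ereal (2 ^ n * (vol n (V + U) / vol n V))"
    by simp
qed

text \<open>For \<open>l = ln n\<close> the inequality \<open>ln t \<le> t - 1\<close> at \<open>t = 1 / l\<close> gives \<open>l + ln l + 1 \<ge> l + 2 - 1 / l\<close>.
  This is at least \<open>1 / 2\<close> as soon as \<open>l \<ge> 1 / 2\<close>, and \<open>n \<ge> 2\<close> supplies the other factor \<open>2\<close>.\<close>

lemma logarithmic_factor_ge_1:
  assumes "n \<ge> 2"
  shows "1 \<le> real n * ln (real n) + real n * ln (ln (real n)) + real n"
proof -
  let ?l = "ln (real n)"
  have ln2: "2 * ln 2 \<ge> (1::real)"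
    using ln_le_minus_one[of "1/2::real"] by (simp add: ln_div)
  have "ln 2 \<le> ?l"
    using assms by simp
  with ln2 have l: "?l \<ge> 1 / 2" by linarith
  have "ln (1 / ?l) \<le> 1 / ?l - 1"
    using l by (intro ln_le_minus_one) simp
  then have "ln ?l \<ge> 1 - 1 / ?l"
    using l by (simp add: ln_div)
  moreover have "1 / ?l \<le> 2"
    using l by (simp add: field_simps)
  ultimately have "1 / 2 \<le> ?l + ln ?l + 1"
    using l by linarith
  then have "2 * (1 / 2) \<le> real n * (?l + ln ?l + 1)"
    using assms by (intro mult_mono) auto
  then show ?thesis
    by (simp add: algebra_simps)
qed

theorem corollary2:
  shows "\<exists>\<epsilon> :: nat \<Rightarrow> real. \<epsilon> \<longlonglongrightarrow> 0 \<and>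
    (\<forall>n\<ge>2. \<forall>U V :: (nat \<Rightarrow> real) set.
       convex_body n U \<and> zero_symmetric U \<and> convex_body n V \<and> zero_symmetric V \<longrightarrow>
       Cn n U V \<le> ereal (2 ^ n *
         (real n * ln (real n) + real n * ln (ln (real n)) + real n + \<epsilon> n * real n) *
         (vol n (V + U) / vol n V)))"
proof (intro exI[of _ "\<lambda>_. 0"] conjI allI impI)
  fix n :: nat and U V :: "(nat \<Rightarrow> real) set"
  assume n: "2 \<le> n"
    and UV: "convex_body n U \<and> zero_symmetric U \<and> convex_body n V \<and> zero_symmetric V"
  let ?q = "real n * ln (real n) + real n * ln (ln (real n)) + real n"
  let ?r = "vol n (V + U) / vol n V"
  have "Cn n U V \<le> ereal (2 ^ n * ?r)"
    using UV by (intro Cn_le) (auto simp: convex_body_def)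
  also have "2 ^ n * ?r \<le> 2 ^ n * ?q * ?r"
  proof (rule mult_right_mono)
    show "(2 :: real) ^ n \<le> 2 ^ n * ?q"
      using logarithmic_factor_ge_1[OF n] by simp
  qed (simp add: vol_def)
  finally show "Cn n U V \<le> ereal (2 ^ n * (?q + 0 * real n) * ?r)"
    by simp
qed simp

end
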